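(* Let $L,n,k$ be positive integers with $2k<n$, fixed. Then, as $q\to\infty$ over prime powers, there exists an $[n,k,L]_q$-AS family of size at least $(1-o(1))\,q^{\,n-2k-\frac{(n-k)(k+1)}{L+1}}$. Consequently $p^{AS}(n,k,L)\ge n-2k-\frac{(n-k)(k+1)}{L+1}$.
   Context: An $[n,k,L]_q$-almost sparse (AS) family is a family $\mathcal F$ of $k$-dimensional linear subspaces of $\mathbb F_q^n$ ($2k<n$) such that (1) distinct members intersect only in $\{0\}$ and (2) every $(k+1)$-dimensional linear subspace of $\mathbb F_q^n$ intersects nontrivially (i.e. in more than $\{0\}$) at most $L$ members of $\mathcal F$. $m^{AS}_q(n,k,L)$ is the maximum size of such a family and $p^{AS}(n,k,L)=\limsup_{q\to\infty}\log_q m^{AS}_q(n,k,L)$. *)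

theory Defs
  imports "HOL-Algebra.Ring" "HOL-Library.Liminf_Limsup" "HOL-Library.Extended_Real"
    "HOL-Computational_Algebra.Primes"
begin

text \<open>Finite fields are HOL-Algebra fields with carrier in nat (every finite field is
isomorphic to one of these). Vectors of F^n are functions nat => nat with entries in the
carrier at positions below n and equal to the field zero at positions >= n.\<close>

definition vecs :: "nat ring \<Rightarrow> nat \<Rightarrow> (nat \<Rightarrow> nat) set" where
  "vecs R n = {v. (\<forall>i<n. v i \<in> carrier R) \<and> (\<forall>i\<ge>n. v i = \<zero>\<^bsub>R\<^esub>)}"

definition zvec :: "nat ring \<Rightarrow> (nat \<Rightarrow> nat)" where
  "zvec R = (\<lambda>i. \<zero>\<^bsub>R\<^esub>)"

definition lincomb :: "nat ring \<Rightarrow> nat \<Rightarrow> nat \<Rightarrow> (nat \<Rightarrow> nat) \<Rightarrow> (nat \<Rightarrow> nat \<Rightarrow> nat) \<Rightarrow> (nat \<Rightarrow> nat)" where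
  "lincomb R n d c vs = (\<lambda>j. if j < n then (\<Oplus>\<^bsub>R\<^esub>i\<in>{..<d}. c i \<otimes>\<^bsub>R\<^esub> vs i j) else \<zero>\<^bsub>R\<^esub>)"

definition lin_indep :: "nat ring \<Rightarrow> nat \<Rightarrow> nat \<Rightarrow> (nat \<Rightarrow> nat \<Rightarrow> nat) \<Rightarrow> bool" where
  "lin_indep R n d vs \<longleftrightarrow>
     (\<forall>c \<in> {..<d} \<rightarrow> carrier R. lincomb R n d c vs = zvec R \<longrightarrow> (\<forall>i<d. c i = \<zero>\<^bsub>R\<^esub>))"

definition span :: "nat ring \<Rightarrow> nat \<Rightarrow> nat \<Rightarrow> (nat \<Rightarrow> nat \<Rightarrow> nat) \<Rightarrow> (nat \<Rightarrow> nat) set" where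
  "span R n d vs = {lincomb R n d c vs | c. c \<in> {..<d} \<rightarrow> carrier R}"

definition subspace_dim :: "nat ring \<Rightarrow> nat \<Rightarrow> nat \<Rightarrow> (nat \<Rightarrow> nat) set \<Rightarrow> bool" where
  "subspace_dim R n d W \<longleftrightarrow>
     (\<exists>vs. (\<forall>i<d. vs i \<in> vecs R n) \<and> lin_indep R n d vs \<and> W = span R n d vs)"

definition meets_nontriv :: "nat ring \<Rightarrow> (nat \<Rightarrow> nat) set \<Rightarrow> (nat \<Rightarrow> nat) set \<Rightarrow> bool" where
  "meets_nontriv R U W \<longleftrightarrow> (\<exists>v \<in> U \<inter> W. v \<noteq> zvec R)"

definition AS_family :: "nat ring \<Rightarrow> nat \<Rightarrow> nat \<Rightarrow> nat \<Rightarrow> (nat \<Rightarrow> nat) set set \<Rightarrow> bool" where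
  "AS_family R n k L \<F> \<longleftrightarrow>
     (\<forall>W\<in>\<F>. subspace_dim R n k W) \<and>
     (\<forall>W1\<in>\<F>. \<forall>W2\<in>\<F>. W1 \<noteq> W2 \<longrightarrow> W1 \<inter> W2 = {zvec R}) \<and>
     (\<forall>U. subspace_dim R n (k+1) U \<longrightarrow> card {W\<in>\<F>. meets_nontriv R U W} \<le> L)"

definition m_AS_field :: "nat ring \<Rightarrow> nat \<Rightarrow> nat \<Rightarrow> nat \<Rightarrow> nat" where
  "m_AS_field R n k L = Max {card \<F> | \<F>. AS_family R n k L \<F>}"

text \<open>m^AS_q: (all fields of order q are isomorphic; we take the supremum over them).\<close>
definition m_AS :: "nat \<Rightarrow> nat \<Rightarrow> nat \<Rightarrow> nat \<Rightarrow> nat" where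
  "m_AS q n k L = Sup {m_AS_field R n k L | R. field R \<and> finite (carrier R) \<and> card (carrier R) = q}"

definition prime_power :: "nat \<Rightarrow> bool" where
  "prime_power q \<longleftrightarrow> (\<exists>p e. prime p \<and> e \<ge> 1 \<and> q = p ^ e)"

definition p_AS :: "nat \<Rightarrow> nat \<Rightarrow> nat \<Rightarrow> ereal" where
  "p_AS n k L = Limsup (inf sequentially (principal {q. prime_power q}))
                  (\<lambda>q. ereal (log (real q) (real (m_AS q n k L))))"

end

theory Submission
  imports Defs "HOL-Number_Theory.Cong"
begin

text \<open>Random selection with deletion. A random \<open>k\<close>-tuple of vectors spans a subspace meeting a fixed
  \<open>m\<close>-dimensional subspace nontrivially with probability \<open>O(q^(k + m - 1 - n))\<close>, and there are
  \<open>O(q^((k + 1) * (n - k - 1)))\<close> subspaces of dimension \<open>k + 1\<close>. For \<open>M = q^e\<close> independent choices,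
  where \<open>e\<close> is the exponent of the theorem, the expected number of pairs of a \<open>(k + 1)\<close>-subspace and
  \<open>L + 1\<close> chosen subspaces all meeting it is \<open>O(q^(- k - 1))\<close>, and the expected number of pairs of
  chosen subspaces meeting each other is \<open>O(M / q)\<close>. Hence some choice has no bad pair of the first
  kind and only \<open>o(M)\<close> of the second; deleting one member of each of the latter leaves the family.\<close>

section \<open>Averaging over all selections\<close>

lemma random_selection:
  fixes T :: "'a set" and B :: "'u \<Rightarrow> 'a set" and P :: "'a \<Rightarrow> 'a \<Rightarrow> bool"
  assumes fin: "finite T" "T \<noteq> {}" "finite \<U>"
    and B: "\<And>U. U \<in> \<U> \<Longrightarrow> B U \<subseteq> T"
    and p: "\<And>U. U \<in> \<U> \<Longrightarrow> real (card (B U)) \<le> p * real (card T)"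
    and r: "\<And>x. x \<in> T \<Longrightarrow> real (card {y \<in> T. P x y}) \<le> r * real (card T)"
    and pos: "M > 0" "\<delta> > 0" "p \<ge> 0" "r \<ge> 0"
    and small: "real (card \<U>) * (real M * p) ^ s + real M * r / \<delta> < 1"
  obtains f where "f \<in> {..<M} \<rightarrow>\<^sub>E T"
    and "\<And>U S. U \<in> \<U> \<Longrightarrow> S \<subseteq> {..<M} \<Longrightarrow> card S = s \<Longrightarrow> \<not> f ` S \<subseteq> B U"
    and "real (card {(i, j). i < j \<and> j < M \<and> P (f i) (f j)}) \<le> \<delta> * real M"
proof -
  define \<Omega> where "\<Omega> = {..<M} \<rightarrow>\<^sub>E T"
  define J where "J = \<U> \<times> {S. S \<subseteq> {..<M} \<and> card S = s}"
  define K where "K = {(i, j). i < j \<and> j < M}"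
  define X where "X f = (\<Sum>(U, S)\<in>J. of_bool (f ` S \<subseteq> B U) :: real)" for f
  define Y where "Y f = (\<Sum>(i, j)\<in>K. of_bool (P (f i) (f j)) :: real)" for f
  have cT: "card T > 0" using fin by auto
  have fO: "finite \<Omega>" unfolding \<Omega>_def using fin by (intro finite_PiE) auto
  have cO: "card \<Omega> = card T ^ M" unfolding \<Omega>_def by (simp add: card_PiE)
  have fS: "finite {S. S \<subseteq> {..<M} \<and> card S = s}"
    by (rule finite_subset[of _ "Pow {..<M}"]) auto
  have fJ: "finite J" unfolding J_def using fin fS by auto
  have K_sub: "K \<subseteq> {..<M} \<times> {..<M}" unfolding K_def by auto
  hence fK: "finite K" by (rule finite_subset) auto
  have cK: "card K \<le> M * M" using card_mono[OF _ K_sub] by (simp add: card_cartesian_product)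
  have cJ: "card J \<le> card \<U> * M ^ s"
  proof -
    have "card {S. S \<subseteq> {..<M} \<and> card S = s} = M choose s"
      using n_subsets[of "{..<M}" s] by simp
    also have "\<dots> \<le> M ^ s"
      using binomial_le_pow[of s M] by (cases "s \<le> M") (auto simp: binomial_eq_0)
    finally show ?thesis unfolding J_def card_cartesian_product by simp
  qed
  have evJ: "real (card {f \<in> \<Omega>. f ` S \<subseteq> B U}) \<le> p ^ s * real (card \<Omega>)"
    if "(U, S) \<in> J" for U S
  proof -
    have S: "S \<subseteq> {..<M}" "card S = s" "U \<in> \<U>" using that unfolding J_def by auto
    have fS': "finite S" using S(1) finite_subset by blast
    \<comment> \<open>The \<open>s\<close> coordinates in \<open>S\<close> are confined to
      \<open>B U\<close> and all others are free, which produces the factor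
      \<open>p ^ s\<close>.\<close>
    have "{f \<in> \<Omega>. f ` S \<subseteq> B U} \<subseteq> PiE {..<M} (\<lambda>i. if i \<in> S then B U else T)"
      unfolding \<Omega>_def using S by (fastforce simp: PiE_iff image_subset_iff)
    hence "card {f \<in> \<Omega>. f ` S \<subseteq> B U} \<le> card (PiE {..<M} (\<lambda>i. if i \<in> S then B U else T))"
      using fin B[OF S(3)] by (intro card_mono finite_PiE) (auto intro: finite_subset)
    also have "\<dots> = (\<Prod>i<M. if i \<in> S then card (B U) else card T)"
      by (simp add: card_PiE if_distrib)
    also have "\<dots> = card (B U) ^ s * card T ^ (M - s)"
    proof -
      have "{..<M} \<inter> {i. i \<in> S} = S" "{..<M} \<inter> - {i. i \<in> S} = {..<M} - S" using S by auto
      thus ?thesis using S fS' by (simp add: prod.If_cases card_Diff_subset)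
    qed
    finally have "real (card {f \<in> \<Omega>. f ` S \<subseteq> B U}) \<le> real (card (B U)) ^ s * real (card T) ^ (M - s)"
      by (subst of_nat_power[symmetric] of_nat_mult[symmetric])+ (rule of_nat_mono)
    also have "\<dots> \<le> (p * real (card T)) ^ s * real (card T) ^ (M - s)"
      by (intro mult_right_mono power_mono p S) auto
    also have "\<dots> = p ^ s * real (card T) ^ (s + (M - s))"
      by (simp add: power_mult_distrib power_add)
    also have "s + (M - s) = M" using S card_mono[of "{..<M}" S] by auto
    finally show ?thesis by (simp add: cO)
  qed
  have evK: "real (card {f \<in> \<Omega>. P (f i) (f j)}) \<le> r * real (card \<Omega>)"
    if "(i, j) \<in> K" for i j
  proof -
    have ij: "i < M" "j < M" "i \<noteq> j" using that unfolding K_def by auto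
    \<comment> \<open>Fixing coordinate \<open>i\<close> at \<open>x\<close> turns the condition on
      coordinate \<open>j\<close> into membership in a fixed set, so \<open>E x\<close> is a
      product; the sizes are then summed over \<open>x\<close>.\<close>
    define E where "E x = PiE {..<M} (\<lambda>l. if l = i then {x} else if l = j then {y \<in> T. P x y} else T)" for x
    have cE: "real (card (E x)) \<le> r * real (card T) ^ (M - 1)" if "x \<in> T" for x
    proof -
      have eq: "{..<M} = insert i (insert j ({..<M} - {i, j}))" using ij by auto
      have "card (E x) = (\<Prod>l<M. if l = i then 1 else if l = j then card {y \<in> T. P x y} else card T)"
        unfolding E_def by (subst card_PiE) (auto intro!: prod.cong)
      also have "\<dots> = card {y \<in> T. P x y} * (\<Prod>l\<in>{..<M} - {i, j}. card T)"
        by (subst eq) (use ij in \<open>auto intro!: prod.cong\<close>)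
      also have "\<dots> = card {y \<in> T. P x y} * card T ^ (M - 2)"
        using ij by (simp add: card_Diff_subset numeral_2_eq_2)
      finally have "real (card (E x)) \<le> (r * real (card T)) * real (card T) ^ (M - 2)"
        using r[OF that] by (simp add: mult_right_mono)
      also have "\<dots> = r * real (card T) ^ Suc (M - 2)" by simp
      also have "Suc (M - 2) = M - 1" using ij by auto
      finally show ?thesis .
    qed
    have "f \<in> E (f i)" "f i \<in> T" if "f \<in> \<Omega>" "P (f i) (f j)" for f
      using that ij unfolding \<Omega>_def E_def by (auto simp: PiE_iff)
    hence "{f \<in> \<Omega>. P (f i) (f j)} \<subseteq> (\<Union>x\<in>T. E x)" by blast
    moreover have "finite (E x)" for x unfolding E_def using fin by (intro finite_PiE) auto
    ultimately have "card {f \<in> \<Omega>. P (f i) (f j)} \<le> card (\<Union>x\<in>T. E x)"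
      using fin by (intro card_mono) auto
    also have "\<dots> \<le> (\<Sum>x\<in>T. card (E x))" by (rule card_UN_le[OF fin(1)])
    finally have "real (card {f \<in> \<Omega>. P (f i) (f j)}) \<le> (\<Sum>x\<in>T. real (card (E x)))"
      by (subst of_nat_sum[symmetric]) (rule of_nat_mono)
    also have "\<dots> \<le> (\<Sum>x\<in>T. r * real (card T) ^ (M - 1))" by (intro sum_mono cE)
    also have "\<dots> = r * real (card T) ^ Suc (M - 1)" by simp
    finally show ?thesis using pos by (simp add: cO)
  qed
  have "(\<Sum>f\<in>\<Omega>. X f) = (\<Sum>(U, S)\<in>J. real (card {f \<in> \<Omega>. f ` S \<subseteq> B U}))"
    unfolding X_def by (subst sum.swap, intro sum.cong)
      (auto simp: fO sum_of_bool_eq Int_def)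
  also have "\<dots> \<le> (\<Sum>(U, S)\<in>J. p ^ s * real (card \<Omega>))"
    by (intro sum_mono) (use evJ in auto)
  also have "\<dots> = real (card J) * (p ^ s * real (card \<Omega>))" by (simp add: case_prod_beta)
  also have "\<dots> \<le> real (card \<U> * M ^ s) * (p ^ s * real (card \<Omega>))"
    using cJ pos by (intro mult_right_mono) (auto simp del: of_nat_mult)
  finally have sX: "(\<Sum>f\<in>\<Omega>. X f) \<le> real (card \<U>) * (real M * p) ^ s * real (card \<Omega>)"
    by (simp add: power_mult_distrib)
  have "(\<Sum>f\<in>\<Omega>. Y f) = (\<Sum>(i, j)\<in>K. real (card {f \<in> \<Omega>. P (f i) (f j)}))"
    unfolding Y_def by (subst sum.swap, intro sum.cong)
      (auto simp: fO sum_of_bool_eq Int_def)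
  also have "\<dots> \<le> (\<Sum>(i, j)\<in>K. r * real (card \<Omega>))"
    by (intro sum_mono) (use evK in auto)
  also have "\<dots> = real (card K) * (r * real (card \<Omega>))" by (simp add: case_prod_beta)
  also have "\<dots> \<le> real (M * M) * (r * real (card \<Omega>))"
    using cK pos by (intro mult_right_mono) (auto simp del: of_nat_mult)
  finally have sY: "(\<Sum>f\<in>\<Omega>. Y f) \<le> real M * real M * r * real (card \<Omega>)" by simp
  have "\<exists>f\<in>\<Omega>. X f + Y f / (\<delta> * real M) < 1"
  proof (rule ccontr)
    assume "\<not> ?thesis"
    hence "(\<Sum>f\<in>\<Omega>. 1) \<le> (\<Sum>f\<in>\<Omega>. X f + Y f / (\<delta> * real M))" by (intro sum_mono) force
    also have "\<dots> = (\<Sum>f\<in>\<Omega>. X f) + (\<Sum>f\<in>\<Omega>. Y f) / (\<delta> * real M)"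
      by (simp add: sum.distrib sum_divide_distrib)
    also have "\<dots> \<le> real (card \<U>) * (real M * p) ^ s * real (card \<Omega>)
        + real M * real M * r * real (card \<Omega>) / (\<delta> * real M)"
      using sX sY pos by (intro add_mono divide_right_mono) auto
    also have "\<dots> = (real (card \<U>) * (real M * p) ^ s + real M * r / \<delta>) * real (card \<Omega>)"
      using pos by (simp add: field_simps)
    also have "\<dots> < 1 * real (card \<Omega>)" using small cO cT by (intro mult_strict_right_mono) auto
    finally show False by simp
  qed
  then obtain f where f: "f \<in> \<Omega>" "X f + Y f / (\<delta> * real M) < 1" by blast
  have X0: "X f \<ge> 0" and Y0: "Y f \<ge> 0" unfolding X_def Y_def by (auto intro!: sum_nonneg)
  have Y1: "Y f / (\<delta> * real M) \<ge> 0" using Y0 pos by simp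
  show thesis
  proof (rule that)
    show "f \<in> {..<M} \<rightarrow>\<^sub>E T" using f unfolding \<Omega>_def by simp
  next
    fix U S assume US: "U \<in> \<U>" "S \<subseteq> {..<M}" "card S = s"
    show "\<not> f ` S \<subseteq> B U"
    proof
      assume "f ` S \<subseteq> B U"
      moreover have "(\<lambda>(U, S). of_bool (f ` S \<subseteq> B U)) (U, S) \<le> X f"
        unfolding X_def using US fJ by (intro member_le_sum) (auto simp: J_def)
      ultimately show False using f(2) Y1 by simp
    qed
  next
    have "Y f = real (card {(i, j). i < j \<and> j < M \<and> P (f i) (f j)})"
    proof -
      have "{(i, j). i < j \<and> j < M \<and> P (f i) (f j)} = K \<inter> {x. P (f (fst x)) (f (snd x))}"
        unfolding K_def by auto
      thus ?thesis unfolding Y_def using fK by (simp add: case_prod_beta sum_of_bool_eq)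
    qed
    moreover have "Y f / (\<delta> * real M) < 1" using f(2) X0 by linarith
    hence "Y f \<le> \<delta> * real M" using pos by (simp add: field_simps)
    ultimately show "real (card {(i, j). i < j \<and> j < M \<and> P (f i) (f j)}) \<le> \<delta> * real M" by simp
  qed
qed

section \<open>Counting tuples and subspaces over a finite field\<close>

locale finite_field = field R for R :: "nat ring" (structure) +
  assumes finite_carrier: "finite (carrier R)"
begin

abbreviation q :: nat where "q \<equiv> card (carrier R)"

lemma card_carrier_ge_2: "q \<ge> 2"
proof -
  have "card {\<zero>, \<one>} \<le> q" using finite_carrier by (intro card_mono) auto
  thus ?thesis by simp
qed

text \<open>Vectors are padded with the field zero while functions in a \<open>PiE\<close> set are
  \<open>undefined\<close> outside their domain; this bijection translates between the two paddings,
  so that vectors can be counted.\<close>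

lemma bij_betw_vecs:
  "bij_betw (\<lambda>f j. if j < n then f j else \<zero>) ({..<n} \<rightarrow>\<^sub>E carrier R) (vecs R n)"
proof (rule bij_betw_byWitness[where f' = "\<lambda>v. restrict v {..<n}"])
  show "\<forall>f\<in>{..<n} \<rightarrow>\<^sub>E carrier R. restrict (\<lambda>j. if j < n then f j else \<zero>) {..<n} = f"
    by (auto simp: fun_eq_iff PiE_iff extensional_def)
  show "\<forall>v\<in>vecs R n. (\<lambda>j. if j < n then restrict v {..<n} j else \<zero>) = v"
    by (auto simp: vecs_def fun_eq_iff)
  show "(\<lambda>f j. if j < n then f j else \<zero>) ` ({..<n} \<rightarrow>\<^sub>E carrier R) \<subseteq> vecs R n"
    unfolding vecs_def using PiE_mem by fastforce
  show "(\<lambda>v. restrict v {..<n}) ` vecs R n \<subseteq> {..<n} \<rightarrow>\<^sub>E carrier R"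
    by (intro image_subsetI restrict_PiE_iff[THEN iffD2]) (auto simp: vecs_def)
qed

lemma finite_vecs: "finite (vecs R n)" and card_vecs: "card (vecs R n) = q ^ n"
  using bij_betw_finite[OF bij_betw_vecs[of n]] bij_betw_same_card[OF bij_betw_vecs[of n]]
    finite_carrier by (auto simp: card_PiE finite_PiE)

section \<open>Linear combinations and spans\<close>

definition vadd :: "(nat \<Rightarrow> nat) \<Rightarrow> (nat \<Rightarrow> nat) \<Rightarrow> nat \<Rightarrow> nat" where
  "vadd v w = (\<lambda>j. v j \<oplus> w j)"

definition smul :: "nat \<Rightarrow> (nat \<Rightarrow> nat) \<Rightarrow> nat \<Rightarrow> nat" where
  "smul a v = (\<lambda>j. a \<otimes> v j)"

lemma vec_in_carrier: "v \<in> vecs R n \<Longrightarrow> v j \<in> carrier R"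
  by (cases "j < n") (auto simp: vecs_def)

lemma smul_zvec: "a \<in> carrier R \<Longrightarrow> smul a (zvec R) = zvec R"
  by (simp add: smul_def zvec_def)

text \<open>Nothing is demanded at indices from \<open>d\<close> on, so a tuple of length
  \<open>Suc d\<close> is also one of length \<open>d\<close>; \<open>lincomb_Suc\<close> and the
  inductions rely on this.\<close>

definition tuple :: "nat \<Rightarrow> nat \<Rightarrow> (nat \<Rightarrow> nat \<Rightarrow> nat) \<Rightarrow> bool" where
  "tuple n d t \<longleftrightarrow> (\<forall>i<d. t i \<in> vecs R n)"

definition coeffs :: "nat \<Rightarrow> (nat \<Rightarrow> nat) \<Rightarrow> bool" where
  "coeffs d c \<longleftrightarrow> (\<forall>i<d. c i \<in> carrier R)"

lemma tuple_entry: "tuple n d t \<Longrightarrow> i < d \<Longrightarrow> t i j \<in> carrier R"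
  unfolding tuple_def using vec_in_carrier by blast

lemma coeffs_entry: "coeffs d c \<Longrightarrow> i < d \<Longrightarrow> c i \<in> carrier R"
  unfolding coeffs_def by blast

lemma lincomb_term:
  "tuple n d t \<Longrightarrow> coeffs d c \<Longrightarrow> i < d \<Longrightarrow> c i \<otimes> t i j \<in> carrier R"
  by (simp add: tuple_entry coeffs_entry)

lemma lincomb_cong:
  assumes "\<And>i. i < d \<Longrightarrow> c i = c' i" "\<And>i. i < d \<Longrightarrow> t i = t' i" "tuple n d t" "coeffs d c"
  shows "lincomb R n d c t = lincomb R n d c' t'"
proof -
  have "(\<Oplus>i\<in>{..<d}. c i \<otimes> t i j) = (\<Oplus>i\<in>{..<d}. c' i \<otimes> t' i j)" for j
    using lincomb_term[OF assms(3,4)] assms(1,2) by (intro finsum_cong') auto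
  thus ?thesis unfolding lincomb_def by auto
qed

lemma lincomb_in_vecs:
  assumes "tuple n d t" "coeffs d c"
  shows "lincomb R n d c t \<in> vecs R n"
  using lincomb_term[OF assms] by (auto simp: vecs_def lincomb_def intro!: finsum_closed)

lemma lincomb_smul:
  assumes "tuple n d t" "coeffs d c" "a \<in> carrier R"
  shows "lincomb R n d (\<lambda>i. a \<otimes> c i) t = smul a (lincomb R n d c t)"
proof -
  have "(\<Oplus>i\<in>{..<d}. a \<otimes> c i \<otimes> t i j) = a \<otimes> (\<Oplus>i\<in>{..<d}. c i \<otimes> t i j)" for j
  proof -
    have "(\<Oplus>i\<in>{..<d}. a \<otimes> c i \<otimes> t i j) = (\<Oplus>i\<in>{..<d}. a \<otimes> (c i \<otimes> t i j))"
      using assms tuple_entry[OF assms(1)] coeffs_entry[OF assms(2)]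
      by (intro finsum_cong') (auto simp: m_assoc)
    thus ?thesis using lincomb_term[OF assms(1,2)] assms(3)
      by (subst finsum_rdistr) auto
  qed
  thus ?thesis using assms(3) by (auto simp: lincomb_def smul_def)
qed

lemma lincomb_add:
  assumes "tuple n d t" "coeffs d c" "coeffs d c'"
  shows "lincomb R n d (\<lambda>i. c i \<oplus> c' i) t = vadd (lincomb R n d c t) (lincomb R n d c' t)"
proof -
  have "(\<Oplus>i\<in>{..<d}. (c i \<oplus> c' i) \<otimes> t i j)
      = (\<Oplus>i\<in>{..<d}. c i \<otimes> t i j) \<oplus> (\<Oplus>i\<in>{..<d}. c' i \<otimes> t i j)" for j
  proof -
    have "(\<Oplus>i\<in>{..<d}. (c i \<oplus> c' i) \<otimes> t i j) = (\<Oplus>i\<in>{..<d}. c i \<otimes> t i j \<oplus> c' i \<otimes> t i j)"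
      using tuple_entry[OF assms(1)] coeffs_entry[OF assms(2)] coeffs_entry[OF assms(3)]
      by (intro finsum_cong') (auto simp: l_distr)
    thus ?thesis using lincomb_term[OF assms(1,2)] lincomb_term[OF assms(1,3)]
      by (subst (asm) finsum_addf) auto
  qed
  thus ?thesis by (auto simp: lincomb_def vadd_def)
qed

lemma lincomb_zero:
  assumes "tuple n d t" "\<And>i. i < d \<Longrightarrow> c i = \<zero>"
  shows "lincomb R n d c t = zvec R"
proof -
  have "(\<Oplus>i\<in>{..<d}. c i \<otimes> t i j) = \<zero>" for j
    using assms(2) tuple_entry[OF assms(1)] by (intro add.finprod_one_eqI) auto
  thus ?thesis by (auto simp: lincomb_def zvec_def)
qed

text \<open>Isolating one summand serves twice: at the last index it gives the recursion
  \<open>lincomb_Suc\<close>, and at an index with coefficient \<open>\<one>\<close> it lets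
  \<open>card_lincomb_fibre_le\<close> solve for the vector at that index.\<close>

lemma lincomb_remove:
  assumes "tuple n d t" "coeffs d c" "i < d" "j < n"
  shows "lincomb R n d c t j = c i \<otimes> t i j \<oplus> (\<Oplus>l\<in>{..<d} - {i}. c l \<otimes> t l j)"
proof -
  have "{..<d} = insert i ({..<d} - {i})" using assms by auto
  hence "lincomb R n d c t j = (\<Oplus>l\<in>insert i ({..<d} - {i}). c l \<otimes> t l j)"
    using assms(4) by (simp add: lincomb_def)
  also have "\<dots> = c i \<otimes> t i j \<oplus> (\<Oplus>l\<in>{..<d} - {i}. c l \<otimes> t l j)"
    using lincomb_term[OF assms(1,2)] assms(3) by (intro finsum_insert) auto
  finally show ?thesis .
qed

lemma lincomb_Suc:
  assumes "tuple n (Suc d) t" "coeffs (Suc d) c"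
  shows "lincomb R n (Suc d) c t = vadd (lincomb R n d c t) (smul (c d) (t d))"
proof
  fix j
  have d: "{..<Suc d} - {d} = {..<d}" by auto
  have c: "(\<Oplus>l\<in>{..<d}. c l \<otimes> t l j) \<in> carrier R"
    using lincomb_term[OF assms] by (intro finsum_closed) auto
  show "lincomb R n (Suc d) c t j = vadd (lincomb R n d c t) (smul (c d) (t d)) j"
  proof (cases "j < n")
    case True
    thus ?thesis using lincomb_remove[OF assms, of d j] c lincomb_term[OF assms, of d j]
      by (simp add: d vadd_def smul_def lincomb_def a_comm[OF c])
  next
    case False
    thus ?thesis using assms
      by (simp add: lincomb_def vadd_def smul_def tuple_def coeffs_def vecs_def)
  qed
qed

lemma lincomb_closed:
  assumes "zvec R \<in> A" "\<And>v w. v \<in> A \<Longrightarrow> w \<in> A \<Longrightarrow> vadd v w \<in> A"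
    "\<And>a v. a \<in> carrier R \<Longrightarrow> v \<in> A \<Longrightarrow> smul a v \<in> A" "A \<subseteq> vecs R n"
    and "\<And>i. i < d \<Longrightarrow> t i \<in> A" "coeffs d c"
  shows "lincomb R n d c t \<in> A"
  using assms(5,6)
proof (induction d)
  case 0
  thus ?case using assms(1) lincomb_zero[of n 0 t c] by (simp add: tuple_def)
next
  case (Suc d)
  have "tuple n (Suc d) t" using Suc.prems assms(4) by (auto simp: tuple_def)
  thus ?case using Suc assms(2,3)
    by (subst lincomb_Suc) (auto simp: coeffs_def)
qed

lemma coeffs_iff_Pi: "c \<in> {..<d} \<rightarrow> carrier R \<longleftrightarrow> coeffs d c"
  by (auto simp: coeffs_def)

lemma coeffs_PiE: "c \<in> {..<d} \<rightarrow>\<^sub>E carrier R \<Longrightarrow> coeffs d c"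
  by (auto simp: coeffs_def)

lemma span_eq: "span R n d t = {lincomb R n d c t |c. coeffs d c}"
  by (simp add: span_def coeffs_iff_Pi)

text \<open>Restricting to the indices below \<open>d\<close> selects one representative of each
  coefficient vector, which makes the span the image of a finite set of known size.\<close>

lemma span_eq_image:
  assumes "tuple n d t"
  shows "span R n d t = (\<lambda>c. lincomb R n d c t) ` ({..<d} \<rightarrow>\<^sub>E carrier R)"
proof -
  have "lincomb R n d c t \<in> (\<lambda>c. lincomb R n d c t) ` ({..<d} \<rightarrow>\<^sub>E carrier R)" if "coeffs d c" for c
  proof (rule image_eqI)
    show "lincomb R n d c t = lincomb R n d (restrict c {..<d}) t"
      using assms that by (intro lincomb_cong) auto
    show "restrict c {..<d} \<in> {..<d} \<rightarrow>\<^sub>E carrier R" using that by (auto simp: coeffs_def)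
  qed
  thus ?thesis by (auto simp: span_eq intro: coeffs_PiE)
qed

lemma lin_indep_iff:
  "lin_indep R n d t \<longleftrightarrow> (\<forall>c. coeffs d c \<longrightarrow> lincomb R n d c t = zvec R \<longrightarrow> (\<forall>i<d. c i = \<zero>))"
  by (auto simp: lin_indep_def coeffs_def Pi_iff)

lemma span_subset_vecs: "tuple n d t \<Longrightarrow> span R n d t \<subseteq> vecs R n"
  by (auto simp: span_eq lincomb_in_vecs)

lemma finite_span: "tuple n d t \<Longrightarrow> finite (span R n d t)"
  by (rule finite_subset[OF span_subset_vecs finite_vecs])

lemma lincomb_in_span: "coeffs d c \<Longrightarrow> lincomb R n d c t \<in> span R n d t"
  unfolding span_eq by blast

lemma zvec_in_span: "tuple n d t \<Longrightarrow> zvec R \<in> span R n d t"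
  using lincomb_in_span[of d "\<lambda>_. \<zero>" n t] lincomb_zero[of n d t "\<lambda>_. \<zero>"]
  by (simp add: coeffs_def)

lemma smul_in_span:
  assumes "tuple n d t" "v \<in> span R n d t" "a \<in> carrier R"
  shows "smul a v \<in> span R n d t"
proof -
  obtain c where "coeffs d c" "v = lincomb R n d c t" using assms by (auto simp: span_eq)
  moreover from this have "coeffs d (\<lambda>i. a \<otimes> c i)" using assms(3) by (auto simp: coeffs_def)
  ultimately show ?thesis using lincomb_smul[OF assms(1)] assms(3) unfolding span_eq by force
qed

lemma vadd_in_span:
  assumes "tuple n d t" "v \<in> span R n d t" "w \<in> span R n d t"
  shows "vadd v w \<in> span R n d t"
proof -
  obtain c c' where c: "coeffs d c" "v = lincomb R n d c t" "coeffs d c'" "w = lincomb R n d c' t"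
    using assms by (auto simp: span_eq)
  hence "coeffs d (\<lambda>i. c i \<oplus> c' i)" by (auto simp: coeffs_def)
  thus ?thesis using lincomb_add[OF assms(1) c(1,3)] c unfolding span_eq by force
qed

lemma span_subset_span:
  assumes "tuple n m s" "\<And>i. i < d \<Longrightarrow> t i \<in> span R n m s"
  shows "span R n d t \<subseteq> span R n m s"
  using assms span_subset_vecs[OF assms(1)]
  by (subst span_eq) (auto intro!: lincomb_closed zvec_in_span vadd_in_span smul_in_span)

lemma card_span:
  assumes "tuple n d t" "lin_indep R n d t"
  shows "card (span R n d t) = q ^ d"
proof -
  have "inj_on (\<lambda>c. lincomb R n d c t) ({..<d} \<rightarrow>\<^sub>E carrier R)"
  proof (rule inj_onI)
    fix c c' assume c: "c \<in> {..<d} \<rightarrow>\<^sub>E carrier R" "c' \<in> {..<d} \<rightarrow>\<^sub>E carrier R"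
      and eq: "lincomb R n d c t = lincomb R n d c' t"
    note cc = c[THEN coeffs_PiE]
    \<comment> \<open>The difference of the two coefficient vectors is written with a factor
      \<open>\<ominus> \<one>\<close> so that \<open>lincomb_add\<close> and
      \<open>lincomb_smul\<close> apply; independence then forces it to vanish.\<close>
    have m: "coeffs d (\<lambda>i. (\<ominus> \<one>) \<otimes> c' i)" using cc by (auto simp: coeffs_def)
    have m': "coeffs d (\<lambda>i. c i \<oplus> (\<ominus> \<one>) \<otimes> c' i)" using cc by (auto simp: coeffs_def)
    have "lincomb R n d (\<lambda>i. c i \<oplus> (\<ominus> \<one>) \<otimes> c' i) t
        = vadd (lincomb R n d c t) (smul (\<ominus> \<one>) (lincomb R n d c t))"
      using lincomb_add[OF assms(1) cc(1) m] lincomb_smul[OF assms(1) cc(2), of "\<ominus> \<one>"] eq by simp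
    also have "\<dots> = zvec R"
      using vec_in_carrier[OF lincomb_in_vecs[OF assms(1) cc(1)]]
      by (simp add: vadd_def smul_def zvec_def l_minus r_neg)
    finally have z: "\<forall>i<d. c i \<oplus> (\<ominus> \<one>) \<otimes> c' i = \<zero>" using assms(2) m' by (simp add: lin_indep_iff)
    have "c i = c' i" if "i < d" for i
    proof -
      have "c i \<in> carrier R" "c' i \<in> carrier R" using cc that by (auto simp: coeffs_def)
      moreover have "c i \<oplus> (\<ominus> \<one>) \<otimes> c' i = \<zero>" using z that by blast
      ultimately show ?thesis using minus_equality[of "c i" "\<ominus> c' i"] by (simp add: l_minus)
    qed
    thus "c = c'" using c by (intro PiE_ext) auto
  qed
  thus ?thesis unfolding span_eq_image[OF assms(1)] by (simp add: card_image card_PiE)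
qed

section \<open>Counting tuples by the linear relations they satisfy\<close>

definition tuples :: "nat \<Rightarrow> (nat \<Rightarrow> nat) set \<Rightarrow> (nat \<Rightarrow> nat \<Rightarrow> nat) set" where
  "tuples d A = ({..<d} \<rightarrow>\<^sub>E A)"

lemma tuple_if_in_tuples: "t \<in> tuples d A \<Longrightarrow> A \<subseteq> vecs R n \<Longrightarrow> tuple n d t"
  by (auto simp: tuples_def tuple_def)

lemma finite_tuples: "finite A \<Longrightarrow> finite (tuples d A)"
  by (auto simp: tuples_def intro: finite_PiE)

lemma card_tuples: "card (tuples d A) = card A ^ d"
  by (simp add: tuples_def card_PiE)

text \<open>Since the coefficient at \<open>i\<close> is \<open>\<one>\<close>, the vector at
  \<open>i\<close> is determined by \<open>v\<close> and the other \<open>d - 1\<close> vectors, so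
  forgetting it is injective on the fibre.\<close>

lemma card_lincomb_fibre_le:
  assumes A: "A \<subseteq> vecs R n" and c: "coeffs d c" "i < d" "c i = \<one>"
  shows "card {t \<in> tuples d A. lincomb R n d c t = v} \<le> card A ^ (d - 1)"
proof -
  let ?F = "{t \<in> tuples d A. lincomb R n d c t = v}" and ?I = "{..<d} - {i}"
  have "inj_on (\<lambda>t. restrict t ?I) ?F"
  proof (rule inj_onI)
    fix t t' assume t: "t \<in> ?F" and t': "t' \<in> ?F" and eq: "restrict t ?I = restrict t' ?I"
    have tt: "tuple n d t" "tuple n d t'" using t t' A by (auto intro: tuple_if_in_tuples)
    have off: "t l = t' l" if "l < d" "l \<noteq> i" for l
      using fun_cong[OF eq, of l] that by simp
    have ti: "t i \<in> vecs R n" "t' i \<in> vecs R n" using tt c by (auto simp: tuple_def)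
    have "t i j = t' i j" for j
    proof (cases "j < n")
      case True
      let ?s = "\<Oplus>l\<in>?I. c l \<otimes> t l j"
      have s: "?s \<in> carrier R" using lincomb_term[OF tt(1) c(1)] by (intro finsum_closed) auto
      have "?s = (\<Oplus>l\<in>?I. c l \<otimes> t' l j)"
        using lincomb_term[OF tt(2) c(1)] off by (intro finsum_cong') auto
      hence "t i j \<oplus> ?s = t' i j \<oplus> ?s"
        using lincomb_remove[OF tt(1) c(1,2) True] lincomb_remove[OF tt(2) c(1,2) True] c(3) t t'
          ti[THEN vec_in_carrier, of j] by simp
      thus ?thesis using s ti[THEN vec_in_carrier, of j] by simp
    next
      case False
      thus ?thesis using ti by (simp add: vecs_def)
    qed
    hence "t l = t' l" if "l < d" for l using off that by (cases "l = i") auto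
    thus "t = t'" using t t' by (intro PiE_ext[of t "{..<d}" "\<lambda>_. A"]) (auto simp: tuples_def)
  qed
  moreover have "(\<lambda>t. restrict t ?I) ` ?F \<subseteq> ?I \<rightarrow>\<^sub>E A"
  proof (intro image_subsetI restrict_PiE_iff[THEN iffD2] ballI)
    fix t l assume "t \<in> ?F" "l \<in> ?I"
    thus "t l \<in> A" using PiE_mem[of t "{..<d}" "\<lambda>_. A" l] by (simp add: tuples_def)
  qed
  moreover have "finite (?I \<rightarrow>\<^sub>E A)" using A finite_vecs[of n] by (intro finite_PiE) (auto intro: finite_subset)
  ultimately have "card ?F \<le> card (?I \<rightarrow>\<^sub>E A)" by (rule card_inj_on_le)
  thus ?thesis using c by (simp add: card_PiE card_Diff_subset)
qed

text \<open>Scaling the coefficients so that one of them is \<open>\<one>\<close> saves the factor \<open>q\<close> over the union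
  bound on all nonzero coefficient vectors; without this saving the final count would not close.\<close>

lemma card_tuples_hitting_le:
  assumes A: "A \<subseteq> vecs R n" and S: "finite S" "\<And>a v. a \<in> carrier R \<Longrightarrow> v \<in> S \<Longrightarrow> smul a v \<in> S"
  shows "card {t \<in> tuples d A. \<exists>c i. coeffs d c \<and> i < d \<and> c i \<noteq> \<zero> \<and> lincomb R n d c t \<in> S}
      \<le> d * q ^ (d - 1) * card S * card A ^ (d - 1)" (is "card ?H \<le> _")
proof -
  define C where "C i = PiE {..<d} (\<lambda>l. if l = i then {\<one>} else carrier R)" for i
  have finA: "finite A" using A finite_vecs finite_subset by blast
  have finC: "finite (C i)" for i unfolding C_def using finite_carrier by (intro finite_PiE) auto
  have cC: "card (C i) = q ^ (d - 1)" if "i < d" for i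
  proof -
    have "card (C i) = (\<Prod>l<d. if l = i then 1 else q)"
      unfolding C_def by (subst card_PiE) (auto intro!: prod.cong)
    also have "\<dots> = (\<Prod>l\<in>{..<d} - {i}. q)"
      using that by (subst prod.remove[of _ i]) (auto intro!: prod.cong)
    finally show ?thesis using that by (simp add: card_Diff_subset)
  qed
  have C: "coeffs d c" "c i = \<one>" if "c \<in> C i" "i < d" for c i
  proof -
    have *: "c l \<in> (if l = i then {\<one>} else carrier R)" if "l < d" for l
      using PiE_mem[OF \<open>c \<in> C i\<close>[unfolded C_def], of l] that by simp
    show "c i = \<one>" using *[OF that(2)] by simp
    show "coeffs d c" unfolding coeffs_def
    proof (intro allI impI)
      fix l assume "l < d"
      thus "c l \<in> carrier R" using *[of l] by (cases "l = i") auto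
    qed
  qed
  let ?F = "\<lambda>c v. {t \<in> tuples d A. lincomb R n d c t = v}"
  have "?H \<subseteq> (\<Union>i<d. \<Union>c\<in>C i. \<Union>v\<in>S. ?F c v)"
  proof
    fix t assume "t \<in> ?H"
    then obtain c i where t: "t \<in> tuples d A" and c: "coeffs d c" "i < d" "c i \<noteq> \<zero>" "lincomb R n d c t \<in> S"
      by blast
    have tt: "tuple n d t" using t A by (rule tuple_if_in_tuples)
    have ci: "c i \<in> Units R" using c by (auto simp: coeffs_def field_Units)
    \<comment> \<open>Dividing by \<open>c i\<close> moves the coefficients into \<open>C i\<close>,
      and the combination stays in \<open>S\<close> because \<open>S\<close> is closed under
      scaling.\<close>
    let ?a = "inv (c i)" and ?c = "restrict (\<lambda>l. inv (c i) \<otimes> c l) {..<d}"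
    have a: "?a \<in> carrier R" using ci by simp
    have "?c \<in> C i" using c a ci by (auto simp: C_def coeffs_def)
    moreover have "lincomb R n d ?c t = lincomb R n d (\<lambda>l. ?a \<otimes> c l) t"
      using tt a c(1) by (intro lincomb_cong) (auto simp: coeffs_def)
    hence "lincomb R n d ?c t \<in> S" using lincomb_smul[OF tt c(1) a] S(2)[OF a c(4)] by simp
    ultimately show "t \<in> (\<Union>i<d. \<Union>c\<in>C i. \<Union>v\<in>S. ?F c v)" using t c(2) by blast
  qed
  hence "card ?H \<le> card (\<Union>i<d. \<Union>c\<in>C i. \<Union>v\<in>S. ?F c v)"
    by (intro card_mono finite_subset[OF _ finite_tuples[OF finA, of d]]) auto
  also have "\<dots> \<le> (\<Sum>i<d. \<Sum>c\<in>C i. \<Sum>v\<in>S. card (?F c v))"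
    by (intro order_trans[OF card_UN_le] sum_mono) (auto simp: finC S)
  also have "\<dots> \<le> (\<Sum>i<d. \<Sum>c\<in>C i. \<Sum>v\<in>S. card A ^ (d - 1))"
    using C by (intro sum_mono card_lincomb_fibre_le[OF A]) auto
  also have "\<dots> = d * q ^ (d - 1) * card S * card A ^ (d - 1)"
    by (simp add: cC)
  finally show ?thesis .
qed

definition indep_tuples :: "nat \<Rightarrow> nat \<Rightarrow> (nat \<Rightarrow> nat) set \<Rightarrow> (nat \<Rightarrow> nat \<Rightarrow> nat) set" where
  "indep_tuples n d A = {t \<in> tuples d A. lin_indep R n d t}"

text \<open>Dependent tuples are those with a nontrivial combination in \<open>{zvec R}\<close>. By
  \<open>card_tuples_hitting_le\<close> they make up at most \<open>d * q ^ (d - 1) / q ^ m\<close>,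
  hence at most \<open>d / q\<close>, of all tuples, and so at most half. Only the size of
  \<open>A\<close> enters, so the bound serves both the whole space and its subspaces.\<close>

lemma card_indep_tuples_ge:
  assumes A: "A \<subseteq> vecs R n" "card A = q ^ m" and d: "d \<le> m" "2 * d \<le> q"
  shows "q ^ (m * d) \<le> 2 * card (indep_tuples n d A)"
\<comment> \<open>The exponents below involve the truncated \<open>d - 1\<close>, so
  \<open>d = 0\<close> is settled first.\<close>
proof (cases "d = 0")
  case True
  thus ?thesis by (auto simp: indep_tuples_def tuples_def lin_indep_def)
next
  case False
  have finA: "finite A" by (rule finite_subset[OF A(1) finite_vecs])
  let ?H = "{t \<in> tuples d A. \<exists>c i. coeffs d c \<and> i < d \<and> c i \<noteq> \<zero> \<and> lincomb R n d c t \<in> {zvec R}}"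
  have "tuples d A \<subseteq> indep_tuples n d A \<union> ?H"
    by (auto simp: indep_tuples_def lin_indep_iff)
  hence "card (tuples d A) \<le> card (indep_tuples n d A \<union> ?H)"
    using finite_tuples[OF finA, of d] by (intro card_mono) (auto simp: indep_tuples_def)
  also have "\<dots> \<le> card (indep_tuples n d A) + card ?H" by (rule card_Un_le)
  finally have 1: "q ^ (m * d) \<le> card (indep_tuples n d A) + card ?H"
    by (simp add: card_tuples A power_mult)
  have "card ?H \<le> d * q ^ (d - 1) * card {zvec R} * card A ^ (d - 1)"
    by (rule card_tuples_hitting_le[OF A(1)]) (auto simp: smul_zvec)
  hence "2 * card ?H \<le> (2 * d) * q ^ (d - 1) * q ^ (m * (d - 1))"
    by (simp add: A power_mult)
  also have "\<dots> \<le> q * q ^ (d - 1) * q ^ (m * (d - 1))"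
    using d by (intro mult_right_mono) auto
  also have "\<dots> = q ^ (d + m * (d - 1))" using False by (cases d) (auto simp: power_add)
  also have "\<dots> \<le> q ^ (m * d)"
  proof (rule power_increasing)
    have "m * d = m + m * (d - 1)" using False by (cases d) auto
    thus "d + m * (d - 1) \<le> m * d" using d by simp
  qed (use card_carrier_ge_2 in auto)
  finally show ?thesis using 1 by simp
qed

lemma subspace_dim_obtain:
  assumes "subspace_dim R n d U"
  obtains t where "tuple n d t" "lin_indep R n d t" "U = span R n d t"
  using assms unfolding subspace_dim_def tuple_def by blast

lemma subspace_dim_subset: "subspace_dim R n d U \<Longrightarrow> U \<subseteq> vecs R n"
  by (metis subspace_dim_obtain span_subset_vecs)

lemma finite_subspaces: "finite {U. subspace_dim R n d U}"
  by (rule finite_subset[of _ "Pow (vecs R n)"]) (auto simp: finite_vecs dest: subspace_dim_subset)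

text \<open>Double counting of pairs of a subspace and an independent \<open>d\<close>-tuple inside
  it: each subspace contains at least \<open>q ^ (d * d) / 2\<close> of them, different subspaces
  share none, and there are at most \<open>q ^ (n * d)\<close> tuples in all.\<close>

lemma card_subspaces_le:
  assumes "2 * d \<le> q"
  shows "card {U. subspace_dim R n d U} * q ^ (d * d) \<le> 2 * q ^ (n * d)"
proof -
  let ?\<U> = "{U. subspace_dim R n d U}"
  have U: "U \<subseteq> vecs R n" "card U = q ^ d" if "subspace_dim R n d U" for U
    using that by (auto elim!: subspace_dim_obtain dest: span_subset_vecs simp: card_span)
  \<comment> \<open>An independent \<open>d\<close>-tuple inside \<open>U\<close> spans a subset of
    \<open>U\<close> with equally many elements, hence \<open>U\<close> itself. This is what makes
    the tuple sets disjoint.\<close>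
  have span: "span R n d t = U" if "subspace_dim R n d U" and t: "t \<in> indep_tuples n d U" for t U
  proof (rule card_subset_eq)
    have tt: "tuple n d t" "lin_indep R n d t"
      using t U[OF that(1)] by (auto simp: indep_tuples_def intro: tuple_if_in_tuples)
    show "finite U" by (rule finite_subset[OF U(1)[OF that(1)] finite_vecs])
    show "span R n d t \<subseteq> U"
    proof -
      obtain s where s: "tuple n d s" "lin_indep R n d s" "U = span R n d s"
        using \<open>subspace_dim R n d U\<close> by (rule subspace_dim_obtain)
      have "t i \<in> span R n d s" if "i < d" for i
        using t that PiE_mem[of t "{..<d}" "\<lambda>_. U" i] s(3) by (simp add: indep_tuples_def tuples_def)
      thus ?thesis using span_subset_span[OF s(1)] s(3) by blast
    qed
    show "card (span R n d t) = card U" using card_span[OF tt] U[OF that(1)] by simp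
  qed
  have fin: "finite (indep_tuples n d U)" if "subspace_dim R n d U" for U
    using finite_tuples[OF finite_subset[OF U(1)[OF that] finite_vecs]] by (simp add: indep_tuples_def)
  have "card ?\<U> * q ^ (d * d) = (\<Sum>U\<in>?\<U>. q ^ (d * d))" by simp
  also have "\<dots> \<le> (\<Sum>U\<in>?\<U>. 2 * card (indep_tuples n d U))"
    using U assms by (intro sum_mono card_indep_tuples_ge) auto
  also have "\<dots> = 2 * (\<Sum>U\<in>?\<U>. card (indep_tuples n d U))" by (simp add: sum_distrib_left)
  also have "(\<Sum>U\<in>?\<U>. card (indep_tuples n d U)) = card (\<Union>U\<in>?\<U>. indep_tuples n d U)"
  proof (rule card_UN_disjoint[symmetric])
    show "\<forall>U\<in>?\<U>. \<forall>W\<in>?\<U>. U \<noteq> W \<longrightarrow> indep_tuples n d U \<inter> indep_tuples n d W = {}"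
    proof (intro ballI impI equals0I)
      fix U W t assume "U \<in> ?\<U>" "W \<in> ?\<U>" "U \<noteq> W" "t \<in> indep_tuples n d U \<inter> indep_tuples n d W"
      thus False using span[of U t] span[of W t] by simp
    qed
  qed (use fin finite_subspaces in auto)
  also have "\<dots> \<le> card (tuples d (vecs R n))"
    using U(1) by (intro card_mono finite_tuples finite_vecs)
      (force simp: indep_tuples_def tuples_def PiE_iff)
  also have "\<dots> = q ^ (n * d)" by (simp add: card_tuples card_vecs power_mult)
  finally show ?thesis by simp
qed


text \<open>A span meets \<open>S\<close> nontrivially only through a combination with a nonzero
  coefficient, so \<open>card_tuples_hitting_le\<close> applies. In terms of probability, a random
  independent tuple meets \<open>S\<close> with probability at most
  \<open>2 * k * q ^ (k - 1) * card S / q ^ n\<close>.\<close>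

lemma card_tuples_meeting_le:
  assumes S: "finite S" "\<And>a v. a \<in> carrier R \<Longrightarrow> v \<in> S \<Longrightarrow> smul a v \<in> S"
    and k: "0 < k" "k \<le> n" "2 * k \<le> q"
  defines "T \<equiv> indep_tuples n k (vecs R n)"
  shows "card {t \<in> T. meets_nontriv R S (span R n k t)} * q ^ n \<le> 2 * k * q ^ (k - 1) * card S * card T"
proof -
  let ?H = "{t \<in> tuples k (vecs R n). \<exists>c i. coeffs k c \<and> i < k \<and> c i \<noteq> \<zero> \<and> lincomb R n k c t \<in> S}"
  have "{t \<in> T. meets_nontriv R S (span R n k t)} \<subseteq> ?H"
  proof
    fix t assume "t \<in> {t \<in> T. meets_nontriv R S (span R n k t)}"
    hence t: "t \<in> tuples k (vecs R n)" and m: "meets_nontriv R S (span R n k t)"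
      by (auto simp: T_def indep_tuples_def)
    have tt: "tuple n k t" using t by (rule tuple_if_in_tuples) simp
    obtain c where c: "coeffs k c" "lincomb R n k c t \<in> S" "lincomb R n k c t \<noteq> zvec R"
      using m unfolding meets_nontriv_def span_eq by blast
    then obtain i where "i < k" "c i \<noteq> \<zero>" using lincomb_zero[OF tt] by blast
    thus "t \<in> ?H" using t c by blast
  qed
  hence "card {t \<in> T. meets_nontriv R S (span R n k t)} \<le> card ?H"
    by (rule card_mono[rotated]) (simp add: finite_tuples finite_vecs)
  also have "\<dots> \<le> k * q ^ (k - 1) * card S * card (vecs R n) ^ (k - 1)"
    by (rule card_tuples_hitting_le[OF order_refl S])
  finally have "card {t \<in> T. meets_nontriv R S (span R n k t)} * q ^ n
      \<le> k * q ^ (k - 1) * card S * (q ^ n) ^ (k - 1) * q ^ n"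
    by (simp add: card_vecs)
  also have "\<dots> = k * q ^ (k - 1) * card S * ((q ^ n) ^ (k - 1) * q ^ n)"
    by (simp only: mult.assoc)
  also have "(q ^ n) ^ (k - 1) * q ^ n = q ^ (n * k)"
    using k(1) by (cases k) (auto simp: power_mult power_add)
  \<comment> \<open>Passing from all tuples to independent ones as the reference set costs the
    factor 2.\<close>
  also have "k * q ^ (k - 1) * card S * q ^ (n * k) \<le> k * q ^ (k - 1) * card S * (2 * card T)"
    unfolding T_def using k by (intro mult_left_mono card_indep_tuples_ge) (auto simp: card_vecs)
  finally show ?thesis by (simp add: mult_ac)
qed

section \<open>AS families over a fixed field\<close>

lemma indep_tuplesD:
  assumes "t \<in> indep_tuples n k (vecs R n)"
  shows "tuple n k t" "lin_indep R n k t" "subspace_dim R n k (span R n k t)"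
proof -
  show 1: "tuple n k t" using assms by (intro tuple_if_in_tuples) (auto simp: indep_tuples_def)
  show 2: "lin_indep R n k t" using assms by (simp add: indep_tuples_def)
  show "subspace_dim R n k (span R n k t)"
    using 1 2 unfolding subspace_dim_def tuple_def by blast
qed

lemma indep_tuples_vecs_nonempty:
  assumes "k \<le> n" "2 * k \<le> q"
  shows "indep_tuples n k (vecs R n) \<noteq> {}"
proof
  assume "indep_tuples n k (vecs R n) = {}"
  moreover have "0 < q ^ (n * k)" using card_carrier_ge_2 by simp
  ultimately show False
    using card_indep_tuples_ge[OF order_refl card_vecs assms] by simp
qed

lemma meets_nontriv_self:
  assumes "tuple n k t" "lin_indep R n k t" "0 < k"
  shows "meets_nontriv R (span R n k t) (span R n k t)"
proof (rule ccontr)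
  assume "\<not> ?thesis"
  hence "span R n k t \<subseteq> {zvec R}" by (auto simp: meets_nontriv_def)
  hence "card (span R n k t) \<le> card {zvec R}" by (intro card_mono) auto
  moreover have "q ^ 1 \<le> q ^ k" using assms(3) card_carrier_ge_2 by (intro power_increasing) auto
  ultimately show False using card_span[OF assms(1,2)] card_carrier_ge_2 by simp
qed

text \<open>Covers negative exponents, where the required size is at most 1.\<close>

lemma AS_family_singleton:
  assumes "k \<le> n" "2 * k \<le> q" "0 < L"
  obtains W where "AS_family R n k L {W}"
proof -
  obtain t where t: "t \<in> indep_tuples n k (vecs R n)"
    using indep_tuples_vecs_nonempty[OF assms(1,2)] by blast
  have "card {W \<in> {span R n k t}. meets_nontriv R U W} \<le> L" for U
  proof -
    have "card {W \<in> {span R n k t}. meets_nontriv R U W} \<le> card {span R n k t}"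
      by (intro card_mono) auto
    thus ?thesis using assms(3) by simp
  qed
  hence "AS_family R n k L {span R n k t}"
    using indep_tuplesD(3)[OF t] by (simp add: AS_family_def)
  thus thesis by (rule that)
qed

text \<open>\<open>random_selection\<close> is applied to independent \<open>k\<close>-tuples, each
  standing for its span, with \<open>s = L + 1\<close>. It excludes \<open>L + 1\<close> indices
  whose spans all meet one \<open>(k + 1)\<close>-dimensional subspace; deleting one index from each
  pair of spans that meet each other costs at most \<open>\<delta> * M\<close> members.\<close>

lemma AS_family_exists:
  fixes M :: nat and \<delta> :: real
  assumes k: "0 < k" "k < n" "2 * (k + 1) \<le> q" and M: "0 < M" "0 < \<delta>"
    and small: "2 * real q ^ ((k + 1) * (n - (k + 1)))
        * (real M * (2 * real k * real q ^ (2 * k) / real q ^ n)) ^ (L + 1)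
      + real M * (2 * real k * real q ^ (2 * k - 1) / real q ^ n) / \<delta> < 1"
  obtains \<F> where "AS_family R n k L \<F>" "real (card \<F>) \<ge> (1 - \<delta>) * real M"
proof -
  define T where "T = indep_tuples n k (vecs R n)"
  define \<U> where "\<U> = {U. subspace_dim R n (k + 1) U}"
  define sp where "sp t = span R n k t" for t
  define B where "B U = {t \<in> T. meets_nontriv R U (sp t)}" for U
  \<comment> \<open>\<open>p\<close> and \<open>r\<close> are the values of
    \<open>2 * k * q ^ (k - 1 + m) / q ^ n\<close>, the bound for meeting an
    \<open>m\<close>-dimensional subspace, at \<open>m = k + 1\<close> and at
    \<open>m = k\<close>.\<close>
  define p where "p = 2 * real k * real q ^ (2 * k) / real q ^ n"
  define r where "r = 2 * real k * real q ^ (2 * k - 1) / real q ^ n"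
  have q0: "real q > 0" using card_carrier_ge_2 by simp
  have finT: "finite T" unfolding T_def indep_tuples_def by (simp add: finite_tuples finite_vecs)
  have bound: "real (card {t \<in> T. meets_nontriv R S (sp t)})
      \<le> 2 * real k * real q ^ (k - 1 + m) / real q ^ n * real (card T)"
    if S: "subspace_dim R n m S" for S m
  proof -
    obtain s where s: "tuple n m s" "lin_indep R n m s" "S = span R n m s"
      using S by (rule subspace_dim_obtain)
    have "card {t \<in> T. meets_nontriv R S (sp t)} * q ^ n \<le> 2 * k * q ^ (k - 1) * card S * card T"
      unfolding T_def sp_def s(3) using k s
      by (intro card_tuples_meeting_le finite_span smul_in_span) auto
    also have "\<dots> = 2 * k * q ^ (k - 1 + m) * card T"
      using card_span[OF s(1,2)] s(3) by (simp add: power_add mult_ac)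
    finally have "real (card {t \<in> T. meets_nontriv R S (sp t)} * q ^ n)
        \<le> real (2 * k * q ^ (k - 1 + m) * card T)" by (rule of_nat_mono)
    thus ?thesis using q0 by (simp add: field_simps)
  qed
  have e1: "k - 1 + (k + 1) = 2 * k" "k - 1 + k = 2 * k - 1" using k by auto
  have cU: "real (card \<U>) \<le> 2 * real q ^ ((k + 1) * (n - (k + 1)))"
  proof -
    \<comment> \<open>Splitting the exponent lets \<open>q ^ ((k + 1) * (k + 1))\<close> cancel from
      \<open>card_subspaces_le\<close>; \<open>n - (k + 1)\<close> is a true difference because
      \<open>k < n\<close>.\<close>
    have "n * (k + 1) = (k + 1) * (k + 1) + (k + 1) * (n - (k + 1))"
      using k by (subst add_mult_distrib2[symmetric]) simp
    hence "card \<U> * q ^ ((k + 1) * (k + 1))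
        \<le> 2 * q ^ ((k + 1) * (n - (k + 1))) * q ^ ((k + 1) * (k + 1))"
      using card_subspaces_le[OF k(3), of n] unfolding \<U>_def
      by (simp only: power_add) (simp only: mult_ac)
    hence "card \<U> \<le> 2 * q ^ ((k + 1) * (n - (k + 1)))"
      using card_carrier_ge_2 by simp
    hence "real (card \<U>) \<le> real (2 * q ^ ((k + 1) * (n - (k + 1))))" by (rule of_nat_mono)
    thus ?thesis by simp
  qed
  have p0: "p \<ge> 0" and r0: "r \<ge> 0" unfolding p_def r_def by auto
  obtain f where f: "f \<in> {..<M} \<rightarrow>\<^sub>E T"
    and fU: "\<And>U S. U \<in> \<U> \<Longrightarrow> S \<subseteq> {..<M} \<Longrightarrow> card S = L + 1 \<Longrightarrow> \<not> f ` S \<subseteq> B U"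
    and fP: "real (card {(i, j). i < j \<and> j < M \<and> meets_nontriv R (sp (f i)) (sp (f j))}) \<le> \<delta> * real M"
  proof (rule random_selection[where T = T and \<U> = \<U> and B = B and p = p and r = r and M = M
        and \<delta> = \<delta> and s = "L + 1" and P = "\<lambda>x y. meets_nontriv R (sp x) (sp y)"])
    show "finite T" by (rule finT)
    show "T \<noteq> {}" unfolding T_def using k by (intro indep_tuples_vecs_nonempty) auto
    show "finite \<U>" unfolding \<U>_def by (rule finite_subspaces)
    show "B U \<subseteq> T" for U unfolding B_def by blast
    show "real (card (B U)) \<le> p * real (card T)" if "U \<in> \<U>" for U
      using bound[of "k + 1" U] that unfolding B_def \<U>_def p_def e1 by simp
    show "real (card {y \<in> T. meets_nontriv R (sp x) (sp y)}) \<le> r * real (card T)" if "x \<in> T" for x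
      using bound[of k "sp x"] indep_tuplesD(3) that unfolding T_def sp_def r_def e1 by simp
    have "real (card \<U>) * (real M * p) ^ (L + 1) + real M * r / \<delta>
        \<le> 2 * real q ^ ((k + 1) * (n - (k + 1))) * (real M * p) ^ (L + 1) + real M * r / \<delta>"
      using cU p0 by (intro add_right_mono mult_right_mono) auto
    thus "real (card \<U>) * (real M * p) ^ (L + 1) + real M * r / \<delta> < 1"
      using small unfolding p_def r_def by linarith
  qed (use M p0 r0 in auto)
  have fT: "f i \<in> T" if "i < M" for i using f that by (auto dest: PiE_mem)
  have sym: "meets_nontriv R U W \<longleftrightarrow> meets_nontriv R W U" for U W
    unfolding meets_nontriv_def by blast
  \<comment> \<open>An index is kept when its span meets none chosen earlier, whether or not the
    earlier one is kept; so only the later index of a bad pair is dropped.\<close>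
  define I where "I = {j. j < M \<and> (\<forall>i<j. \<not> meets_nontriv R (sp (f i)) (sp (f j)))}"
  have sep: "\<not> meets_nontriv R (sp (f i)) (sp (f j))" if "i \<in> I" "j \<in> I" "i \<noteq> j" for i j
    using that sym unfolding I_def by (cases i j rule: linorder_cases) auto
  have IM: "I \<subseteq> {..<M}" unfolding I_def by auto
  hence finI: "finite I" by (rule finite_subset) simp
  have self: "meets_nontriv R (sp (f i)) (sp (f i))" if "i < M" for i
    using fT[OF that] k unfolding T_def sp_def by (intro meets_nontriv_self indep_tuplesD) auto
  \<comment> \<open>Repeated spans are removed too: a span meets itself nontrivially as
    \<open>k > 0\<close>, so two kept indices cannot share it. Hence the family is as large as
    \<open>I\<close>.\<close>
  have inj: "inj_on (\<lambda>i. sp (f i)) I"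
  proof (rule inj_onI, rule ccontr)
    fix i j assume "i \<in> I" "j \<in> I" "sp (f i) = sp (f j)" "i \<noteq> j"
    thus False using sep[of i j] self[of i] IM by auto
  qed
  have AS: "AS_family R n k L ((\<lambda>i. sp (f i)) ` I)"
    unfolding AS_family_def
  proof (intro conjI ballI impI allI)
    fix W assume "W \<in> (\<lambda>i. sp (f i)) ` I"
    thus "subspace_dim R n k W" using fT IM unfolding T_def sp_def by (auto intro!: indep_tuplesD)
  next
    fix W1 W2 assume "W1 \<in> (\<lambda>i. sp (f i)) ` I" "W2 \<in> (\<lambda>i. sp (f i)) ` I" "W1 \<noteq> W2"
    then obtain i j where ij: "i \<in> I" "j \<in> I" "i \<noteq> j" "W1 = sp (f i)" "W2 = sp (f j)" by blast
    have "zvec R \<in> sp (f i)" if "i \<in> I" for i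
      using fT[of i] that IM unfolding T_def sp_def by (auto intro!: zvec_in_span indep_tuplesD)
    thus "W1 \<inter> W2 = {zvec R}" using sep[OF ij(1-3)] ij unfolding meets_nontriv_def by blast
  next
    fix U assume U: "subspace_dim R n (k + 1) U"
    let ?I = "{i \<in> I. meets_nontriv R U (sp (f i))}"
    have "{W \<in> (\<lambda>i. sp (f i)) ` I. meets_nontriv R U W} = (\<lambda>i. sp (f i)) ` ?I" by blast
    hence "card {W \<in> (\<lambda>i. sp (f i)) ` I. meets_nontriv R U W} \<le> card ?I"
      using finI by (simp add: card_image_le)
    also have "card ?I \<le> L"
    proof (rule ccontr)
      assume "\<not> card ?I \<le> L"
      then obtain S where S: "S \<subseteq> ?I" "card S = L + 1"
        by (metis (no_types, lifting) Suc_eq_plus1 not_less_eq_eq obtain_subset_with_card_n)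
      have "f ` S \<subseteq> B U" unfolding B_def using S fT IM by auto
      moreover have "S \<subseteq> {..<M}" using S IM by blast
      ultimately show False using fU[of U S] U S by (simp add: \<U>_def)
    qed
    finally show "card {W \<in> (\<lambda>i. sp (f i)) ` I. meets_nontriv R U W} \<le> L" .
  qed
  let ?K = "{(i, j). i < j \<and> j < M \<and> meets_nontriv R (sp (f i)) (sp (f j))}"
  have "?K \<subseteq> {..<M} \<times> {..<M}" by (clarsimp split: prod.splits)
  hence finK: "finite ?K" by (rule finite_subset) simp
  \<comment> \<open>Every dropped index is the second entry of a bad pair, so at most
    \<open>card ?K\<close> indices are lost.\<close>
  have "{..<M} \<subseteq> I \<union> snd ` ?K"
  proof
    fix j assume j: "j \<in> {..<M}"
    show "j \<in> I \<union> snd ` ?K"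
    proof (cases "j \<in> I")
      case False
      then obtain i where "(i, j) \<in> ?K" using j unfolding I_def by auto
      hence "snd (i, j) \<in> snd ` ?K" by (rule imageI)
      thus ?thesis by simp
    qed simp
  qed
  hence "card {..<M} \<le> card (I \<union> snd ` ?K)" using finI finK by (intro card_mono) auto
  also have "\<dots> \<le> card I + card (snd ` ?K)" by (rule card_Un_le)
  also have "\<dots> \<le> card I + card ?K" using card_image_le[OF finK] by simp
  finally have "real M \<le> real (card I) + \<delta> * real M" using fP by simp
  hence "real (card ((\<lambda>i. sp (f i)) ` I)) \<ge> (1 - \<delta>) * real M"
    using card_image[OF inj] by (simp add: algebra_simps)
  with AS show thesis by (rule that)
qed

end

section \<open>Asymptotics\<close>

text \<open>The exponent \<open>e\<close> is chosen so that
  \<open>e + 2 * k - n = - w / (L + 1)\<close> with \<open>w = (n - k) * (k + 1)\<close>. The power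
  \<open>L + 1\<close> then yields \<open>q powr (- w)\<close>, which outweighs the number of
  \<open>(k + 1)\<close>-dimensional subspaces. The factor 2 in the bound on \<open>M\<close> leaves
  room for rounding up.\<close>

lemma selection_bound_eventually:
  fixes n k L :: nat and \<delta> :: real
  defines "e \<equiv> real n - 2 * real k - (real n - real k) * (real k + 1) / (real L + 1)"
  assumes k: "2 * k < n" "0 < k" and e: "e \<ge> 0" and \<delta>: "\<delta> > 0"
  obtains C :: real where "\<And>q M :: nat. real q \<ge> C \<Longrightarrow> q \<ge> 1 \<Longrightarrow> real M \<le> 2 * real q powr e \<Longrightarrow>
    2 * real q ^ ((k + 1) * (n - (k + 1)))
        * (real M * (2 * real k * real q ^ (2 * k) / real q ^ n)) ^ (L + 1)
      + real M * (2 * real k * real q ^ (2 * k - 1) / real q ^ n) / \<delta> < 1"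
proof -
  \<comment> \<open>The two terms of \<open>D\<close> are the constants of the two summands; each
    summand is at most its constant divided by \<open>q\<close>.\<close>
  define D where "D = 2 * (4 * real k) ^ (L + 1) + 4 * real k / \<delta>"
  define w where "w = (real n - real k) * (real k + 1)"
  have w0: "w \<ge> 0" unfolding w_def using k by simp
  have ew: "e + 2 * real k - real n = - w / (real L + 1)" unfolding e_def w_def by simp
  show thesis
  proof (rule that[of "D + 1"])
    fix q M :: nat
    assume qD: "real q \<ge> D + 1" and q1: "q \<ge> 1" and M: "real M \<le> 2 * real q powr e"
    define x where "x = real q"
    have x1: "x \<ge> 1" and x0: "x > 0" using q1 unfolding x_def by auto
    have pw: "x ^ m = x powr real m" for m using x0 by (simp add: powr_realpow)
    have "real M * (2 * real k * x ^ (2 * k) / x ^ n) \<le> 2 * x powr e * (2 * real k * x ^ (2 * k) / x ^ n)"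
      using M x0 unfolding x_def by (intro mult_right_mono) auto
    also have "\<dots> = 4 * real k * x powr (e + 2 * real k - real n)"
      by (simp add: pw powr_add powr_diff)
    finally have "(real M * (2 * real k * x ^ (2 * k) / x ^ n)) ^ (L + 1)
        \<le> (4 * real k * x powr (- w / (real L + 1))) ^ (L + 1)"
      unfolding ew using x0 by (intro power_mono) auto
    also have "\<dots> = (4 * real k) ^ (L + 1) * x powr (- w)"
    proof -
      have "(x powr (- w / (real L + 1))) ^ (L + 1) = x powr (- w / (real L + 1) * real (L + 1))"
        using x0 by (simp only: powr_realpow[symmetric] powr_powr powr_gt_zero)
      also have "- w / (real L + 1) * real (L + 1) = - w" by (simp add: field_simps)
      finally show ?thesis by (simp only: power_mult_distrib)
    qed
    finally have "2 * x ^ ((k + 1) * (n - (k + 1))) * (real M * (2 * real k * x ^ (2 * k) / x ^ n)) ^ (L + 1)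
        \<le> 2 * x ^ ((k + 1) * (n - (k + 1))) * ((4 * real k) ^ (L + 1) * x powr (- w))"
      using x0 by (intro mult_left_mono) auto
    also have "\<dots> = 2 * (4 * real k) ^ (L + 1) * x powr (real ((k + 1) * (n - (k + 1))) - w)"
      unfolding pw[of "(k + 1) * (n - (k + 1))"] powr_diff powr_minus_divide by simp
    \<comment> \<open>The exponent is \<open>(k + 1) * (n - k - 1) - (k + 1) * (n - k)\<close>:
      counting the subspaces falls short of \<open>w\<close> by one factor
      \<open>k + 1\<close>.\<close>
    also have "real ((k + 1) * (n - (k + 1))) - w = - (real k + 1)"
    proof -
      have "real (n - (k + 1)) = real n - (real k + 1)" using k by (simp add: of_nat_diff)
      thus ?thesis unfolding w_def of_nat_mult by (simp add: algebra_simps)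
    qed
    also have "2 * (4 * real k) ^ (L + 1) * x powr (- (real k + 1)) \<le> 2 * (4 * real k) ^ (L + 1) * x powr (- 1)"
      using x1 by (intro mult_left_mono powr_mono) auto
    finally have A: "2 * x ^ ((k + 1) * (n - (k + 1))) * (real M * (2 * real k * x ^ (2 * k) / x ^ n)) ^ (L + 1)
        \<le> 2 * (4 * real k) ^ (L + 1) * x powr (- 1)" .
    have "real M * (2 * real k * x ^ (2 * k - 1) / x ^ n) / \<delta>
        \<le> 2 * x powr e * (2 * real k * x ^ (2 * k - 1) / x ^ n) / \<delta>"
      using M x0 \<delta> unfolding x_def by (intro divide_right_mono mult_right_mono) auto
    also have "\<dots> = 4 * real k / \<delta> * x powr (e + real (2 * k - 1) - real n)"
      by (simp add: pw powr_add powr_diff mult_ac)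
    also have "\<dots> \<le> 4 * real k / \<delta> * x powr (- 1)"
    proof (intro mult_left_mono powr_mono)
      have "real (2 * k - 1) = 2 * real k - 1" using k by (simp add: of_nat_diff)
      moreover have "- w / (real L + 1) \<le> 0" using w0 by simp
      ultimately show "e + real (2 * k - 1) - real n \<le> - 1" using ew by linarith
    qed (use x1 \<delta> in auto)
    finally have "2 * x ^ ((k + 1) * (n - (k + 1))) * (real M * (2 * real k * x ^ (2 * k) / x ^ n)) ^ (L + 1)
        + real M * (2 * real k * x ^ (2 * k - 1) / x ^ n) / \<delta> \<le> D * x powr (- 1)"
      using A unfolding D_def by (simp add: algebra_simps)
    also have "\<dots> < 1" using qD x0 unfolding x_def by (simp add: powr_minus_divide)
    finally show "2 * real q ^ ((k + 1) * (n - (k + 1)))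
        * (real M * (2 * real k * real q ^ (2 * k) / real q ^ n)) ^ (L + 1)
      + real M * (2 * real k * real q ^ (2 * k - 1) / real q ^ n) / \<delta> < 1"
      unfolding x_def .
  qed
qed

section \<open>Prime fields realised on natural numbers\<close>

definition prime_field :: "nat \<Rightarrow> nat ring" where
  "prime_field p = \<lparr>carrier = {..<p}, monoid.mult = \<lambda>x y. x * y mod p, one = 1,
     zero = 0, add = \<lambda>x y. (x + y) mod p\<rparr>"

lemma field_prime_field:
  assumes "prime p"
  shows "field (prime_field p)"
proof -
  have p: "p > 1" using assms by (rule prime_gt_1_nat)
  have "abelian_group (prime_field p)"
  proof (rule abelian_groupI)
    fix x assume x: "x \<in> carrier (prime_field p)"
    show "\<exists>y\<in>carrier (prime_field p). y \<oplus>\<^bsub>prime_field p\<^esub> x = \<zero>\<^bsub>prime_field p\<^esub>"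
      \<comment> \<open>The reduction matters at \<open>x = 0\<close>, where \<open>p - x\<close>
        lies outside the carrier.\<close>
      using x p by (intro bexI[of _ "(p - x) mod p"]) (auto simp: prime_field_def mod_add_left_eq)
  qed (use p in \<open>auto simp: prime_field_def mod_simps add_ac\<close>)
  moreover have "comm_monoid (prime_field p)"
    by (rule comm_monoidI) (use p in \<open>auto simp: prime_field_def mod_simps mult_ac\<close>)
  ultimately have "cring (prime_field p)"
    by (rule cringI) (auto simp: prime_field_def mod_simps algebra_simps)
  then interpret cring "prime_field p" .
  show ?thesis
  proof (rule cring_fieldI2)
    fix a assume a: "a \<in> carrier (prime_field p)" "a \<noteq> \<zero>\<^bsub>prime_field p\<^esub>"
    hence "\<not> p dvd a" using p by (auto simp: prime_field_def dest: dvd_imp_le)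
    hence "coprime a p" using assms prime_imp_coprime coprime_commute by blast
    then obtain b where "[a * b = Suc 0] (mod p)" using cong_solve_coprime_nat by blast
    hence "a * (b mod p) mod p = 1" using p by (simp add: cong_def mod_simps)
    thus "\<exists>b\<in>carrier (prime_field p). a \<otimes>\<^bsub>prime_field p\<^esub> b = \<one>\<^bsub>prime_field p\<^esub>"
      using p by (intro bexI[of _ "b mod p"]) (auto simp: prime_field_def)
  qed (simp add: prime_field_def)
qed

lemma card_prime_field: "finite (carrier (prime_field p))" "card (carrier (prime_field p)) = p"
  by (simp_all add: prime_field_def)

section \<open>From families to \<open>m_AS\<close> and the upper limit\<close>

lemma card_AS_family_le:
  assumes "field R" "finite (carrier R)" "AS_family R n k L \<F>"
  shows "card \<F> \<le> 2 ^ (card (carrier R) ^ n)"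
proof -
  interpret field R by (rule assms)
  interpret finite_field R by unfold_locales (rule assms)
  have "\<F> \<subseteq> Pow (vecs R n)"
  proof (intro subsetI PowI)
    fix W v assume "W \<in> \<F>" "v \<in> W"
    thus "v \<in> vecs R n" using subspace_dim_subset[of n k W] assms(3) by (auto simp: AS_family_def)
  qed
  hence "card \<F> \<le> card (Pow (vecs R n))"
    by (rule card_mono[rotated]) (simp add: finite_vecs)
  thus ?thesis by (simp add: card_Pow finite_vecs card_vecs)
qed

text \<open>\<open>Max\<close> and \<open>Sup\<close> on naturals bound members of a set reliably
  only when the set is bounded. The crude bound \<open>?b\<close> depends on the order of the field
  alone, so it serves for the \<open>Max\<close> over families and for the \<open>Sup\<close> over
  all fields of that order.\<close>

lemma card_AS_family_le_m_AS:
  assumes "field R" "finite (carrier R)" "AS_family R n k L \<F>"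
  shows "card \<F> \<le> m_AS (card (carrier R)) n k L"
proof -
  let ?b = "2 ^ (card (carrier R) ^ n) :: nat"
  have fin: "finite {card \<F> |\<F>. AS_family R' n k L \<F>}"
    and le: "m_AS_field R' n k L \<le> ?b"
    if R': "field R'" "finite (carrier R')" "card (carrier R') = card (carrier R)" for R' :: "nat ring"
  proof -
    have sub: "{card \<F> |\<F>. AS_family R' n k L \<F>} \<subseteq> {..?b}"
      using card_AS_family_le[OF R'(1,2)] R'(3) by auto
    thus fin: "finite {card \<F> |\<F>. AS_family R' n k L \<F>}" by (rule finite_subset) simp
    \<comment> \<open>The empty family keeps the set nonempty, as \<open>Max_in\<close>
      requires.\<close>
    have "AS_family R' n k L {}" by (simp add: AS_family_def)
    hence "{card \<F> |\<F>. AS_family R' n k L \<F>} \<noteq> {}" by blast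
    hence "m_AS_field R' n k L \<in> {card \<F> |\<F>. AS_family R' n k L \<F>}"
      unfolding m_AS_field_def by (rule Max_in[OF fin])
    thus "m_AS_field R' n k L \<le> ?b" using sub by blast
  qed
  have "card \<F> \<le> m_AS_field R n k L"
    unfolding m_AS_field_def using assms by (intro Max_ge fin) auto
  also have "\<dots> \<le> m_AS (card (carrier R)) n k L"
    unfolding m_AS_def
  proof (rule cSup_upper)
    show "bdd_above {m_AS_field R' n k L |R'. field R' \<and> finite (carrier R') \<and> card (carrier R') = card (carrier R)}"
      using le by (intro bdd_aboveI[of _ ?b]) blast
  qed (use assms in blast)
  finally show ?thesis .
qed

text \<open>For \<open>e < 0\<close> the target is at most 1 and a single subspace suffices. For
  \<open>e \<ge> 0\<close> the number of choices is \<open>q powr e\<close> rounded up, which is at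
  most twice \<open>q powr e\<close> because \<open>q powr e \<ge> 1\<close>.\<close>

lemma AS_family_asymptotic:
  fixes n k L :: nat and \<epsilon> :: real
  defines "e \<equiv> real n - 2 * real k - (real n - real k) * (real k + 1) / (real L + 1)"
  assumes k: "0 < k" "2 * k < n" and "0 < L" "0 < \<epsilon>"
  obtains Q :: nat where "\<And>R :: nat ring. field R \<Longrightarrow> finite (carrier R) \<Longrightarrow> card (carrier R) \<ge> Q \<Longrightarrow>
    \<exists>\<F>. AS_family R n k L \<F> \<and> real (card \<F>) \<ge> (1 - \<epsilon>) * real (card (carrier R)) powr e"
proof (cases "e \<ge> 0")
  case False
  show thesis
  proof (rule that[of "2 * k"])
    fix R :: "nat ring" assume R: "field R" "finite (carrier R)" and q: "card (carrier R) \<ge> 2 * k"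
    interpret field R by (rule R)
    interpret finite_field R by unfold_locales (rule R)
    obtain W where W: "AS_family R n k L {W}"
      using AS_family_singleton[of k n L] k q \<open>0 < L\<close> by auto
    have "real q powr e \<le> real q powr 0" using False card_carrier_ge_2 by (intro powr_mono) auto
    hence "real q powr e \<le> 1" using card_carrier_ge_2 by simp
    moreover have "(1 - \<epsilon>) * real q powr e \<le> 1 * real q powr e"
      using \<open>0 < \<epsilon>\<close> by (intro mult_right_mono) auto
    ultimately have "(1 - \<epsilon>) * real q powr e \<le> real (card {W})" by simp
    with W show "\<exists>\<F>. AS_family R n k L \<F> \<and> real (card \<F>) \<ge> (1 - \<epsilon>) * real q powr e" by blast
  qed
next
  case True
  obtain C :: real where C: "\<And>q M :: nat. real q \<ge> C \<Longrightarrow> q \<ge> 1 \<Longrightarrow> real M \<le> 2 * real q powr e \<Longrightarrow>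
    2 * real q ^ ((k + 1) * (n - (k + 1)))
        * (real M * (2 * real k * real q ^ (2 * k) / real q ^ n)) ^ (L + 1)
      + real M * (2 * real k * real q ^ (2 * k - 1) / real q ^ n) / \<epsilon> < 1"
    using selection_bound_eventually[of k n L \<epsilon>] k \<open>0 < \<epsilon>\<close> True unfolding e_def by metis
  show thesis
  proof (rule that[of "max (nat \<lceil>C\<rceil>) (2 * (k + 1))"])
    fix R :: "nat ring" assume R: "field R" "finite (carrier R)"
      and Q: "card (carrier R) \<ge> max (nat \<lceil>C\<rceil>) (2 * (k + 1))"
    interpret field R by (rule R)
    interpret finite_field R by unfold_locales (rule R)
    have qC: "real q \<ge> C" using Q by linarith
    have q1: "real q powr e \<ge> 1" using True card_carrier_ge_2 by (intro ge_one_powr_ge_zero) auto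
    define M where "M = nat \<lceil>real q powr e\<rceil>"
    have M: "real M \<ge> real q powr e" "real M \<le> 2 * real q powr e" "0 < M"
      using q1 unfolding M_def by linarith+
    obtain \<F> where F: "AS_family R n k L \<F>" "real (card \<F>) \<ge> (1 - \<epsilon>) * real M"
      using AS_family_exists[of k n M \<epsilon> L] C[of q M] qC M k Q \<open>0 < \<epsilon>\<close> card_carrier_ge_2 by auto
    have "(1 - \<epsilon>) * real q powr e \<le> real (card \<F>)"
    \<comment> \<open>For \<open>\<epsilon> > 1\<close> the factor \<open>1 - \<epsilon>\<close> is
      negative and reverses the comparison with \<open>M\<close>, but then the target itself is
      negative.\<close>
    proof (cases "\<epsilon> \<le> 1")
      case True
      hence "(1 - \<epsilon>) * real q powr e \<le> (1 - \<epsilon>) * real M" using M by (intro mult_left_mono) auto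
      thus ?thesis using F(2) by linarith
    next
      case False
      hence "(1 - \<epsilon>) * real q powr e \<le> 0" by (intro mult_nonpos_nonneg) auto
      thus ?thesis by (rule order_trans) simp
    qed
    with F(1) show "\<exists>\<F>. AS_family R n k L \<F> \<and> real (card \<F>) \<ge> (1 - \<epsilon>) * real q powr e" by blast
  qed
qed

text \<open>Only prime orders are needed for the lower bound on the upper limit.\<close>

lemma p_AS_ge:
  fixes n k L Q :: nat and e :: real
  assumes large: "\<And>R :: nat ring. field R \<Longrightarrow> finite (carrier R) \<Longrightarrow> card (carrier R) \<ge> Q \<Longrightarrow>
    \<exists>\<F>. AS_family R n k L \<F> \<and> real (card \<F>) \<ge> 1 / 2 * real (card (carrier R)) powr e"
  shows "p_AS n k L \<ge> ereal e"
  unfolding p_AS_def Limsup_def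
proof (rule INF_greatest)
  fix P assume "P \<in> {P. eventually P (inf sequentially (principal {q. prime_power q}))}"
  then obtain N where N: "\<And>q. q \<ge> N \<Longrightarrow> prime_power q \<Longrightarrow> P q"
    by (auto simp: eventually_inf_principal eventually_sequentially)
  let ?f = "\<lambda>q. ereal (log (real q) (real (m_AS q n k L)))"
  \<comment> \<open>The loss \<open>\<eta>\<close> absorbs the factor \<open>1 / 2\<close>: a prime
    \<open>p\<close> above \<open>2 powr (1 / \<eta>)\<close> has
    \<open>p powr \<eta> \<ge> 2\<close>.\<close>
  have "ereal e \<le> (SUP q\<in>Collect P. ?f q) + ereal \<eta>" if \<eta>: "\<eta> > 0" for \<eta>
  proof -
    obtain p where p: "prime p" "p > max (max N Q) (nat \<lceil>2 powr (1 / \<eta>)\<rceil>)"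
      using bigger_prime by blast
    have p1: "real p > 1" using prime_gt_1_nat[OF p(1)] by simp
    have "prime_power p" unfolding prime_power_def using p(1) by (intro exI[of _ p] exI[of _ 1]) simp
    hence Pp: "P p" using N p(2) by simp
    obtain \<F> where F: "AS_family (prime_field p) n k L \<F>" "real (card \<F>) \<ge> 1 / 2 * real p powr e"
      using large[OF field_prime_field[OF p(1)]] card_prime_field[of p] p(2) by auto
    have "card \<F> \<le> m_AS p n k L"
      using card_AS_family_le_m_AS[OF field_prime_field[OF p(1)] _ F(1)] card_prime_field[of p] by simp
    hence m: "1 / 2 * real p powr e \<le> real (m_AS p n k L)" using F(2) by linarith
    have "2 powr (1 / \<eta>) \<le> real p" using p(2) by linarith
    hence "(2 powr (1 / \<eta>)) powr \<eta> \<le> real p powr \<eta>" using \<eta> by (intro powr_mono2) auto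
    hence "2 \<le> real p powr \<eta>" using \<eta> by (simp add: powr_powr)
    hence "real p powr (e - \<eta>) \<le> 1 / 2 * real p powr e"
      using p1 by (simp add: powr_diff field_simps)
    hence "real p powr (e - \<eta>) \<le> real (m_AS p n k L)" using m by linarith
    moreover from this have "real (m_AS p n k L) > 0"
      by (rule less_le_trans[rotated]) (use p1 in simp)
    ultimately have "e - \<eta> \<le> log (real p) (real (m_AS p n k L))"
      using p1 by (subst le_log_iff) auto
    hence "ereal e \<le> ?f p + ereal \<eta>" by simp
    also have "?f p + ereal \<eta> \<le> (SUP q\<in>Collect P. ?f q) + ereal \<eta>"
      using Pp by (intro add_right_mono SUP_upper) simp
    finally show ?thesis .
  qed
  thus "ereal e \<le> (SUP q\<in>Collect P. ?f q)" by (rule ereal_le_epsilon2)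
qed

theorem mainTheorem9:
  fixes n k L :: nat
  assumes "n > 0" "k > 0" "L > 0" "2 * k < n"
  shows "(\<forall>\<epsilon>>0. \<exists>Q. \<forall>R :: nat ring. field R \<and> finite (carrier R) \<and> card (carrier R) \<ge> Q \<longrightarrow>
            (\<exists>\<F>. AS_family R n k L \<F> \<and>
               real (card \<F>) \<ge> (1 - \<epsilon>) * real (card (carrier R)) powr
                 (real n - 2 * real k - (real n - real k) * (real k + 1) / (real L + 1))))
      \<and> p_AS n k L \<ge> ereal (real n - 2 * real k - (real n - real k) * (real k + 1) / (real L + 1))"
proof
  show "\<forall>\<epsilon>>0. \<exists>Q. \<forall>R :: nat ring. field R \<and> finite (carrier R) \<and> card (carrier R) \<ge> Q \<longrightarrow>
            (\<exists>\<F>. AS_family R n k L \<F> \<and>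
               real (card \<F>) \<ge> (1 - \<epsilon>) * real (card (carrier R)) powr
                 (real n - 2 * real k - (real n - real k) * (real k + 1) / (real L + 1)))"
    using AS_family_asymptotic[OF assms(2,4,3)] by (metis (lifting))
  \<comment> \<open>The choice of 1/2 is arbitrary: a constant factor in (0, 1) disappears in the
    limit of the logarithm to base \<open>q\<close>.\<close>
  obtain Q where "\<And>R :: nat ring. field R \<Longrightarrow> finite (carrier R) \<Longrightarrow> card (carrier R) \<ge> Q \<Longrightarrow>
    \<exists>\<F>. AS_family R n k L \<F> \<and> real (card \<F>) \<ge> (1 - 1 / 2) * real (card (carrier R)) powr
      (real n - 2 * real k - (real n - real k) * (real k + 1) / (real L + 1))"
    using AS_family_asymptotic[OF assms(2,4,3), of "1 / 2"] by auto
  thus "p_AS n k L \<ge> ereal (real n - 2 * real k - (real n - real k) * (real k + 1) / (real L + 1))"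
    by (intro p_AS_ge) auto
qed

end
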